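(* Let $A,B\in\mathbb{C}^{d\times d}$ be simultaneously diagonalizable with $A$ positive definite: there is a basis $v_1,\dots,v_d$ of $\mathbb{C}^d$ with $Av_i=\lambda_iv_i$, $Bv_i=\gamma_iv_i$, $\lambda_i>0$, $\gamma_i\in\mathbb{C}$. Let $\mu_i=\lambda_i^{-1}\gamma_i$, let $\tau>0$, and consider the system $y'(t)=-Ay(t)+By(t-\tau)$. (a) Given a step size $h>0$, the IMEX BDF method (BDF2 or BDF3) is stable for this system if $\mu_i\in D(0,\sigma_{z_i})$ for all $i=1,\dots,d$, where $z_i=-h\lambda_i$ and $\sigma_{z}$ is the quantity associated with the method considered. (b) Equivalently, when $|\mu_i|<1$ for all $i$, it is sufficient for stability that $h<\min_i\frac{|\chi(|\mu_i|)|}{\lambda_i}$ for IMEX BDF2, and that $h<\min_i\frac{|\tilde\chi(|\mu_i|)|}{\lambda_i}$ for IMEX BDF3 (with the convention that $|\chi(r)|=+\infty$ for $r\le\frac13$ and $|\tilde\chi(r)|=+\infty$ for $r\le\frac17$). (c) If $|\mu_i|\le\frac13$ for all $i=1,\dots,d$, then IMEX BDF2 is unconditionally stable for the system; if additionally $|\mu_i|\le\frac17$ for all $i=1,\dots,d$, then IMEX BDF3 is unconditionally stable for the system.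
   Context: $D(0,r)=\{\mu\in\mathbb{C}:|\mu|<r\}$ is the open disk. Methods. Step sizes are $h=\tau/m$ with $m\ge 1$ an integer. The $s$-step IMEX BDF method applied to $y'(t)=-Ay(t)+By(t-\tau)$ is $$\sum_{j=0}^{s}\alpha_j y_{n+j}=-h\sum_{j=0}^{s}\beta_jAy_{n+j}+h\sum_{j=0}^{s-1}\beta_j^*By_{n+j-m}.$$ Put $\rho(\zeta)=\sum_j\alpha_j\zeta^j$, $\sigma(\zeta)=\sum_j\beta_j\zeta^j$, $\sigma^*(\zeta)=\sum_j\beta^*_j\zeta^j$. IMEX BDF2 ($s=2$): $\rho(\zeta)=\frac32\zeta^2-2\zeta+\frac12$, $\sigma(\zeta)=\zeta^2$, $\sigma^*(\zeta)=2\zeta-1$. IMEX BDF3 ($s=3$): $\rho(\zeta)=\frac{11}{6}\zeta^3-3\zeta^2+\frac32\zeta-\frac13$, $\sigma(\zeta)=\zeta^3$, $\sigma^*(\zeta)=3\zeta^2-3\zeta+1$. Stability. The method with step size $h=\tau/m$ is stable for the system if every root $\zeta\in\mathbb{C}$ of $$\det\big(\zeta^m(\rho(\zeta)I+h\,\sigma(\zeta)A)-h\,\sigma^*(\zeta)B\big)=0$$ satisfies $|\zeta|<1$. It is unconditionally stable for the system if it is stable for every step size $h$. For real $z<0$ put $$\sigma_z=\inf_{|\zeta|=1}\frac{|\rho(\zeta)-z\sigma(\zeta)|}{|z|\,|\sigma^*(\zeta)|},$$ and write $\psi(z)=\sigma_z$ for IMEX BDF2 and $\tilde\psi(z)=\sigma_z$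 for IMEX BDF3. For $\frac13<r\le1$, $\chi(r)=\min\{z<0:\psi(z)=r\}$; for $\frac17<r\le 1$, $\tilde\chi(r)=\min\{z<0:\tilde\psi(z)=r\}$. *)

theory Defs
  imports "HOL-Analysis.Analysis" "HOL-Computational_Algebra.Polynomial"
begin

text \<open>
  An IMEX linear multistep formula for \<open>y'(t) = - A y(t) + B y(t - \<tau>)\<close>,
  given by its generating polynomials \<open>\<rho>(\<zeta>) = \<Sum>\<^sub>j \<alpha>\<^sub>j \<zeta>\<^sup>j\<close>, \<open>\<sigma>(\<zeta>) = \<Sum>\<^sub>j \<beta>\<^sub>j \<zeta>\<^sup>j\<close>
  (implicit part) and \<open>\<sigma>\<^sup>*(\<zeta>) = \<Sum>\<^sub>j \<beta>\<^sup>*\<^sub>j \<zeta>\<^sup>j\<close> (explicit part).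
\<close>
record imex =
  rho :: "complex poly"
  sigma :: "complex poly"
  sigma_star :: "complex poly"

text \<open>Coefficient lists of polynomials start with the constant term.\<close>

definition imex_bdf2 :: imex where
  "imex_bdf2 = \<lparr> rho = [:1/2, -2, 3/2:], sigma = [:0, 0, 1:], sigma_star = [:-1, 2:] \<rparr>"

definition imex_bdf3 :: imex where
  "imex_bdf3 = \<lparr> rho = [:-1/3, 3/2, -3, 11/6:], sigma = [:0, 0, 0, 1:], sigma_star = [:1, -3, 3:] \<rparr>"

definition scale_matrix :: "complex \<Rightarrow> complex^'n^'n \<Rightarrow> complex^'n^'n" where
  "scale_matrix c A = (\<chi> i j. c * A $ i $ j)"

text \<open>The step size is \<open>h = \<tau> / m\<close>; note that \<open>mat c\<close> is \<open>c\<close> times the identity matrix.\<close>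
definition imex_stable :: "imex \<Rightarrow> complex^'n^'n \<Rightarrow> complex^'n^'n \<Rightarrow> real \<Rightarrow> nat \<Rightarrow> bool" where
  "imex_stable M A B \<tau> m \<longleftrightarrow>
    (let h = complex_of_real (\<tau> / real m) in
     \<forall>\<zeta>::complex.
       det (scale_matrix (\<zeta> ^ m)
              (mat (poly (rho M) \<zeta>) + scale_matrix (h * poly (sigma M) \<zeta>) A)
            - scale_matrix (h * poly (sigma_star M) \<zeta>) B) = 0
       \<longrightarrow> cmod \<zeta> < 1)"

definition imex_unconditionally_stable ::
    "imex \<Rightarrow> complex^'n^'n \<Rightarrow> complex^'n^'n \<Rightarrow> real \<Rightarrow> bool" where
  "imex_unconditionally_stable M A B \<tau> \<longleftrightarrow> (\<forall>m\<ge>1. imex_stable M A B \<tau> m)"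

text \<open>
  The quantity \<open>\<sigma>\<^sub>z\<close>, for real \<open>z < 0\<close>. For the two BDF formulas \<open>\<sigma>\<^sup>*\<close> has no zero on the unit
  circle, so the quotient never divides by zero.
\<close>
definition sigma_inf :: "imex \<Rightarrow> real \<Rightarrow> real" where
  "sigma_inf M z =
    (INF \<zeta>\<in>sphere (0::complex) 1.
       cmod (poly (rho M) \<zeta> - complex_of_real z * poly (sigma M) \<zeta>)
       / (\<bar>z\<bar> * cmod (poly (sigma_star M) \<zeta>)))"

definition psi :: "real \<Rightarrow> real" where
  "psi = sigma_inf imex_bdf2"

definition psi_tilde :: "real \<Rightarrow> real" where
  "psi_tilde = sigma_inf imex_bdf3"

text \<open>Meaningful for \<open>1/3 < r \<le> 1\<close>.\<close>
definition chi :: "real \<Rightarrow> real" where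
  "chi r = (LEAST z. z < 0 \<and> psi z = r)"

text \<open>Meaningful for \<open>1/7 < r \<le> 1\<close>.\<close>
definition chi_tilde :: "real \<Rightarrow> real" where
  "chi_tilde r = (LEAST z. z < 0 \<and> psi_tilde z = r)"

text \<open>Absolute values with the convention that they are infinite for small arguments.\<close>

definition abs_chi :: "real \<Rightarrow> ereal" where
  "abs_chi r = (if r \<le> 1/3 then \<infinity> else ereal \<bar>chi r\<bar>)"

definition abs_chi_tilde :: "real \<Rightarrow> ereal" where
  "abs_chi_tilde r = (if r \<le> 1/7 then \<infinity> else ereal \<bar>chi_tilde r\<bar>)"

end

theory Submission
  imports Defs "HOL-Complex_Analysis.Conformal_Mappings"
begin

text \<open>
  In the common eigenbasis the characteristic equation splits into scalar equations
  \<open>\<zeta>\<^sup>m (\<rho>(\<zeta>) - z \<sigma>(\<zeta>)) = - z \<mu> \<sigma>\<^sup>*(\<zeta>)\<close>. Since \<open>\<rho> - z \<sigma>\<close> has no zero outside the unit disk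
  for \<open>z < 0\<close>, the maximum modulus principle carries the bound defining \<open>\<sigma>\<^sub>z\<close> from the unit circle
  to \<open>|\<zeta>| \<ge> 1\<close>, which excludes roots there. For the \<open>\<chi>\<close>-form of the condition, put
  \<open>t = - 1 / z\<close> and \<open>x = 1 - Re \<zeta>\<close>: the squared quotient becomes \<open>(1 + 2 t P x + t\<^sup>2 R x) / S x\<close> with
  explicit polynomials, and its infimum over \<open>\<zeta>\<close> is a continuous function of \<open>t\<close> that increases
  strictly from \<open>1/3\<close> (BDF2) or \<open>1/7\<close> (BDF3) until it reaches \<open>1\<close> at a finite \<open>t\<close>. Each level
  \<open>r < 1\<close> above the starting value is therefore attained exactly once.
\<close>

section \<open>Roots of the characteristic equation\<close>

text \<open>Each \<open>v i\<close> is the image of \<open>inverse (c i) *s v i\<close>, so the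
  range of \<open>C\<close> contains a spanning set. Surjectivity yields a right inverse, and
  determinants multiply.\<close>

lemma det_nonzero_if_eigenbasis:
  fixes C :: "complex^'n^'n" and v :: "'n \<Rightarrow> complex^'n"
  assumes span: "vec.span (range v) = UNIV"
    and eig: "\<And>i. C *v v i = c i *s v i" and nz: "\<And>i. c i \<noteq> 0"
  shows "det C \<noteq> 0"
proof -
  have "v i \<in> range ((*v) C)" for i
  proof
    show "v i = C *v (inverse (c i) *s v i)"
      by (simp add: vector_scalar_commute eig nz)
  qed simp
  hence "range v \<subseteq> range ((*v) C)" by auto
  moreover have "vec.subspace (range ((*v) C))"
    by (intro vec.linear_subspace_image vec.subspace_UNIV matrix_vector_mul_linear_gen)
  ultimately have "surj ((*v) C)"
    using vec.span_minimal[of "range v" "range ((*v) C)"] span by auto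
  then obtain C' where "C ** C' = mat 1"
    using matrix_right_invertible_surjective[of C] by blast
  hence "det C * det C' = 1" by (metis det_mul det_I)
  thus ?thesis by auto
qed

lemma scale_matrix_mult_vec: "scale_matrix c A *v x = c *s (A *v x)"
  by (simp add: scale_matrix_def vec_eq_iff matrix_vector_mult_def sum_distrib_left mult.assoc)

lemma mat_mult_vec: "mat c *v x = c *s (x :: complex^'n)"
  by (simp add: mat_def vec_eq_iff matrix_vector_mult_def if_distrib[of "\<lambda>y. y * _"] cong: if_cong)

text \<open>
  \<open>P\<close> and \<open>Q\<close> are the polynomials \<open>p\<close> and \<open>q\<close> in the variable \<open>w = 1/\<zeta>\<close>; the bound on the unit
  circle extends to \<open>|w| \<le> 1\<close> by the maximum modulus principle for \<open>Q/P\<close>.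
\<close>
lemma root_inside_unit_disk:
  fixes p q P Q :: "complex poly"
  assumes p: "\<And>\<zeta>. \<zeta> \<noteq> 0 \<Longrightarrow> poly p \<zeta> = \<zeta> ^ s * poly P (1 / \<zeta>)"
    and q: "\<And>\<zeta>. \<zeta> \<noteq> 0 \<Longrightarrow> poly q \<zeta> = \<zeta> ^ s * poly Q (1 / \<zeta>)"
    and P: "\<And>w. cmod w \<le> 1 \<Longrightarrow> poly P w \<noteq> 0"
    and bound: "\<And>\<zeta>. cmod \<zeta> = 1 \<Longrightarrow> \<kappa> * cmod (poly q \<zeta>) \<le> cmod (poly p \<zeta>)"
    and a: "cmod a < \<kappa>"
    and root: "\<zeta> ^ m * poly p \<zeta> = a * poly q \<zeta>"
  shows "cmod \<zeta> < 1"
proof (rule ccontr)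
  assume "\<not> cmod \<zeta> < 1"
  hence z: "cmod \<zeta> \<ge> 1" "\<zeta> \<noteq> 0" by auto
  have kpos: "\<kappa> > 0" using a norm_ge_zero[of a] by linarith
  define w where "w = 1 / \<zeta>"
  have w: "cmod w \<le> 1" using z by (simp add: w_def norm_divide)
  let ?f = "\<lambda>w. poly Q w / poly P w"
  have "cmod (?f w) \<le> 1 / \<kappa>"
  proof (rule maximum_modulus_frontier[of ?f "cball 0 1"])
    show "?f holomorphic_on interior (cball 0 1)"
      using P by (intro holomorphic_intros) auto
    show "continuous_on (closure (cball 0 1)) ?f"
      using P by (intro continuous_intros) auto
    show "cmod (?f y) \<le> 1 / \<kappa>" if "y \<in> frontier (cball 0 1)" for y
    proof -
      have y: "cmod y = 1" "y \<noteq> 0" using that by auto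
      have "\<kappa> * cmod (poly q (1 / y)) \<le> cmod (poly p (1 / y))"
        using y by (intro bound) (simp add: norm_divide)
      hence "\<kappa> * cmod (poly Q y) \<le> cmod (poly P y)"
        using y p[of "1 / y"] q[of "1 / y"] by (simp add: norm_mult norm_divide norm_power)
      thus ?thesis using P[of y] y kpos by (simp add: norm_divide field_simps)
    qed
  qed (use w in auto)
  hence 1: "\<kappa> * cmod (poly Q w) \<le> cmod (poly P w)"
    using P[OF w] kpos by (simp add: norm_divide field_simps)
  have "\<zeta> ^ m * poly P w = a * poly Q w"
    using root z p[of \<zeta>] q[of \<zeta>] by (simp add: w_def)
  hence "cmod \<zeta> ^ m * cmod (poly P w) = cmod a * cmod (poly Q w)"
    by (metis norm_mult norm_power)
  \<comment> \<open>The delay only enlarges the left side outside the disk, so the estimate is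
    uniform in \<open>m\<close>.\<close>
  moreover have "cmod \<zeta> ^ m * cmod (poly P w) \<ge> 1 * cmod (poly P w)"
    using z by (intro mult_right_mono) auto
  ultimately have 2: "cmod (poly P w) \<le> cmod a * cmod (poly Q w)" by simp
  show False
  proof (cases "poly Q w = 0")
    case True
    thus False using 2 P[OF w] by simp
  next
    case False
    hence "cmod a * cmod (poly Q w) < \<kappa> * cmod (poly Q w)" using a by simp
    thus False using 1 2 by linarith
  qed
qed

text \<open>Clearing denominators gives the circle bound of \<open>root_inside_unit_disk\<close>
  with \<kappa> = |z| \<open>sigma_inf M z\<close>; where \<open>sigma_star\<close> vanishes the
  left side is 0.\<close>

lemma sigma_inf_le:
  assumes "z < 0" and "cmod \<zeta> = 1"
  shows "\<bar>z\<bar> * sigma_inf M z * cmod (poly (sigma_star M) \<zeta>)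
    \<le> cmod (poly (rho M - smult (of_real z) (sigma M)) \<zeta>)"
proof -
  have "sigma_inf M z \<le> cmod (poly (rho M) \<zeta> - of_real z * poly (sigma M) \<zeta>)
       / (\<bar>z\<bar> * cmod (poly (sigma_star M) \<zeta>))"
    unfolding sigma_inf_def using assms(2)
    by (intro cINF_lower bdd_belowI[of _ 0]) auto
  moreover have "0 < \<bar>z\<bar> * cmod (poly (sigma_star M) \<zeta>)" if "poly (sigma_star M) \<zeta> \<noteq> 0"
    using that assms(1) by (intro mult_pos_pos) auto
  ultimately show ?thesis
    by (cases "poly (sigma_star M) \<zeta> = 0") (auto simp: pos_le_divide_eq mult_ac)
qed

lemma imex_stable_if_sigma_inf:
  fixes A B :: "complex^'d^'d" and v :: "'d \<Rightarrow> complex^'d" and lam :: "'d \<Rightarrow> real"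
  assumes span: "vec.span (range v) = UNIV"
    and A: "\<And>i. A *v v i = complex_of_real (lam i) *s v i"
    and B: "\<And>i. B *v v i = gam i *s v i"
    and lam: "\<And>i. lam i > 0"
    and mu: "\<And>i. mu i = inverse (complex_of_real (lam i)) * gam i"
    and tau: "\<tau> > 0" and m: "m \<ge> 1"
    and P: "\<And>z \<zeta>. \<zeta> \<noteq> 0 \<Longrightarrow>
      poly (rho M - smult (of_real z) (sigma M)) \<zeta> = \<zeta> ^ s * poly (P z) (1 / \<zeta>)"
    and Q: "\<And>\<zeta>. \<zeta> \<noteq> 0 \<Longrightarrow> poly (sigma_star M) \<zeta> = \<zeta> ^ s * poly Q (1 / \<zeta>)"
    and P0: "\<And>z w. z < 0 \<Longrightarrow> cmod w \<le> 1 \<Longrightarrow> poly (P z) w \<noteq> 0"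
    and small: "\<And>i. cmod (mu i) < sigma_inf M (- (\<tau> / real m) * lam i)"
  shows "imex_stable M A B \<tau> m"
  unfolding imex_stable_def Let_def
proof (intro allI impI)
  fix \<zeta> :: complex
  define h where "h = \<tau> / real m"
  have h: "h > 0" using tau m by (simp add: h_def)
  define C where "C = scale_matrix (\<zeta> ^ m)
              (mat (poly (rho M) \<zeta>) + scale_matrix (h * poly (sigma M) \<zeta>) A)
            - scale_matrix (h * poly (sigma_star M) \<zeta>) B"
  assume "det (scale_matrix (\<zeta> ^ m)
              (mat (poly (rho M) \<zeta>) + scale_matrix (complex_of_real (\<tau> / real m) * poly (sigma M) \<zeta>) A)
            - scale_matrix (complex_of_real (\<tau> / real m) * poly (sigma_star M) \<zeta>) B) = 0"
  hence det: "det C = 0" by (simp add: C_def h_def)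
  \<comment> \<open>\<open>c i\<close> is the eigenvalue of the characteristic matrix on
    \<open>v i\<close>; a zero determinant forces one of them to vanish.\<close>
  define c where "c i = \<zeta> ^ m * (poly (rho M) \<zeta> + h * poly (sigma M) \<zeta> * lam i)
      - h * poly (sigma_star M) \<zeta> * gam i" for i
  have "C *v v i = c i *s v i" for i
    by (simp add: C_def c_def scale_matrix_mult_vec mat_mult_vec A B algebra_simps
        matrix_vector_mult_add_rdistrib matrix_vector_mult_diff_rdistrib vector_smult_assoc
        vector_add_ldistrib vector_sub_rdistrib vector_sadd_rdistrib)
  then obtain i where i: "c i = 0"
    using det_nonzero_if_eigenbasis[OF span, of C c] det by blast
  define z where "z = - h * lam i"
  have z: "z < 0" using h lam[of i] by (simp add: z_def)
  have gam: "gam i = lam i * mu i" using lam[of i] by (simp add: mu)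
  have small': "cmod (mu i) < sigma_inf M z" using small[of i] by (simp add: z_def h_def)
  show "cmod \<zeta> < 1"
  proof (rule root_inside_unit_disk[OF P Q P0[OF z] sigma_inf_le[OF z]])
    show "cmod (- of_real z * mu i) < \<bar>z\<bar> * sigma_inf M z"
      using z small' by (simp add: norm_mult)
    show "\<zeta> ^ m * poly (rho M - smult (of_real z) (sigma M)) \<zeta>
        = - of_real z * mu i * poly (sigma_star M) \<zeta>"
      using i by (simp add: c_def z_def gam algebra_simps)
  qed
qed

section \<open>The infimum as a function of $t = -1/z$\<close>

text \<open>Dividing through by |z| makes the quotient meaningful also at \<open>t = 0\<close>, the
  limit of z tending to minus infinity.\<close>

definition imex_ratio :: "imex \<Rightarrow> real \<Rightarrow> complex \<Rightarrow> real" where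
  "imex_ratio M t \<zeta> = cmod (of_real t * poly (rho M) \<zeta> + poly (sigma M) \<zeta>) / cmod (poly (sigma_star M) \<zeta>)"

definition imex_inf :: "imex \<Rightarrow> real \<Rightarrow> real" where
  "imex_inf M t = (INF \<zeta>\<in>sphere 0 1. imex_ratio M t \<zeta>)"

lemma sigma_inf_eq_imex_inf:
  assumes "z < 0"
  shows "sigma_inf M z = imex_inf M (- 1 / z)"
proof -
  have "cmod (poly (rho M) \<zeta> - of_real z * poly (sigma M) \<zeta>) / (\<bar>z\<bar> * cmod (poly (sigma_star M) \<zeta>))
      = imex_ratio M (- 1 / z) \<zeta>" for \<zeta>
  proof -
    have "poly (rho M) \<zeta> - of_real z * poly (sigma M) \<zeta>
        = - of_real z * (of_real (- 1 / z) * poly (rho M) \<zeta> + poly (sigma M) \<zeta>)"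
      using assms by (simp add: field_simps)
    hence "cmod (poly (rho M) \<zeta> - of_real z * poly (sigma M) \<zeta>)
        = \<bar>z\<bar> * cmod (of_real (- 1 / z) * poly (rho M) \<zeta> + poly (sigma M) \<zeta>)"
      by (simp only: norm_mult norm_minus_cancel norm_of_real)
    thus ?thesis using assms by (simp add: imex_ratio_def)
  qed
  thus ?thesis by (simp add: sigma_inf_def imex_inf_def)
qed

lemma imex_inf_le: "cmod \<zeta> = 1 \<Longrightarrow> imex_inf M t \<le> imex_ratio M t \<zeta>"
  unfolding imex_inf_def by (intro cINF_lower bdd_belowI[of _ 0]) (auto simp: imex_ratio_def)

text \<open>
  The infimum increases strictly from \<open>r0\<close> at \<open>t = 0\<close> until it reaches the value \<open>1\<close>, which is the
  ratio at \<open>\<zeta> = 1\<close>. In \<open>ratio_less\<close>, the second alternative is needed for BDF3: not being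
  A-stable, its ratio may decrease in \<open>t\<close> for \<open>\<zeta>\<close> near \<open>1\<close>, but only where it is not minimal.
\<close>
locale imex_profile =
  fixes M :: imex and r0 T :: real
  assumes sigma_star_nz: "cmod \<zeta> = 1 \<Longrightarrow> poly (sigma_star M) \<zeta> \<noteq> 0"
    and ratio_one: "imex_ratio M t 1 = 1"
    and ratio_less: "0 \<le> s \<Longrightarrow> s < t \<Longrightarrow> cmod \<zeta> = 1 \<Longrightarrow> \<zeta> \<noteq> 1 \<Longrightarrow>
      imex_ratio M s \<zeta> < imex_ratio M t \<zeta> \<or> imex_ratio M s (- 1) < imex_ratio M t \<zeta>"
    and ratio_zero: "cmod \<zeta> = 1 \<Longrightarrow> r0 \<le> imex_ratio M 0 \<zeta>"
    and ratio_zero_minus_one: "imex_ratio M 0 (- 1) = r0"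
    and T_nonneg: "0 \<le> T"
    and ratio_T: "cmod \<zeta> = 1 \<Longrightarrow> 1 \<le> imex_ratio M T \<zeta>"
begin

lemma imex_inf_attained: "\<exists>\<zeta>. cmod \<zeta> = 1 \<and> imex_inf M t = imex_ratio M t \<zeta>"
proof -
  have "continuous_on (sphere 0 1) (imex_ratio M t)"
    unfolding imex_ratio_def using sigma_star_nz by (intro continuous_intros) auto
  then obtain \<zeta> where \<zeta>: "\<zeta> \<in> sphere 0 1" "\<And>\<xi>. \<xi> \<in> sphere 0 1 \<Longrightarrow> imex_ratio M t \<zeta> \<le> imex_ratio M t \<xi>"
    using continuous_attains_inf[of "sphere (0::complex) 1" "imex_ratio M t"] by auto
  have "imex_ratio M t \<zeta> \<le> imex_inf M t"
    unfolding imex_inf_def using \<zeta> by (intro cINF_greatest) auto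
  thus ?thesis using \<zeta>(1) imex_inf_le[of \<zeta> M t] by (intro exI[of _ \<zeta>]) auto
qed

lemma imex_inf_ge: "(\<And>\<zeta>. cmod \<zeta> = 1 \<Longrightarrow> r \<le> imex_ratio M t \<zeta>) \<Longrightarrow> r \<le> imex_inf M t"
  using imex_inf_attained[of t] by auto

lemma imex_inf_le_1: "imex_inf M t \<le> 1"
  using imex_inf_le[of 1 M t] ratio_one[of t] by simp

lemma imex_inf_0: "imex_inf M 0 = r0"
  using imex_inf_le[of "-1" M 0] imex_inf_ge[of r0 0] ratio_zero ratio_zero_minus_one
  by (intro antisym) auto

lemma imex_inf_T: "imex_inf M T = 1"
  using imex_inf_ge[of 1 T] imex_inf_le_1[of T] ratio_T by force

text \<open>Take a minimiser for the larger parameter \<open>t\<close>. It differs from 1, where the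
  ratio is 1, so either alternative of \<open>ratio_less\<close> supplies a point with a smaller
  ratio at \<open>s\<close>.\<close>

lemma imex_inf_strict_mono:
  assumes "0 \<le> s" "s < t" "imex_inf M t < 1"
  shows "imex_inf M s < imex_inf M t"
proof -
  obtain \<zeta> where \<zeta>: "cmod \<zeta> = 1" "imex_inf M t = imex_ratio M t \<zeta>"
    using imex_inf_attained by blast
  have "\<zeta> \<noteq> 1" using \<zeta> assms ratio_one[of t] by auto
  from ratio_less[OF assms(1,2) \<zeta>(1) this] show ?thesis
    using \<zeta> imex_inf_le[of \<zeta> M s] imex_inf_le[of "-1" M s] by auto
qed

text \<open>On the circle the ratios are Lipschitz in \<open>t\<close> with a common constant, the
  maximum of |\<rho>| / |\<sigma>*|, and an infimum of such functions inherits the constant.\<close>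

lemma continuous_on_imex_inf: "continuous_on X (imex_inf M)"
proof -
  have "continuous_on (sphere 0 1) (\<lambda>\<zeta>. cmod (poly (rho M) \<zeta>) / cmod (poly (sigma_star M) \<zeta>))"
    using sigma_star_nz by (intro continuous_intros) auto
  then obtain \<xi> where \<xi>: "\<And>\<zeta>. cmod \<zeta> = 1 \<Longrightarrow>
      cmod (poly (rho M) \<zeta>) / cmod (poly (sigma_star M) \<zeta>)
      \<le> cmod (poly (rho M) \<xi>) / cmod (poly (sigma_star M) \<xi>)"
    using continuous_attains_sup[of "sphere (0::complex) 1"
        "\<lambda>\<zeta>. cmod (poly (rho M) \<zeta>) / cmod (poly (sigma_star M) \<zeta>)"]
    by (metis compact_sphere empty_iff mem_sphere_0 norm_one)
  define K where "K = cmod (poly (rho M) \<xi>) / cmod (poly (sigma_star M) \<xi>)"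
  have ratio: "imex_ratio M t \<zeta> \<le> imex_ratio M s \<zeta> + K * \<bar>t - s\<bar>" if "cmod \<zeta> = 1" for s t \<zeta>
  proof -
    let ?r = "poly (rho M) \<zeta>" and ?s = "poly (sigma M) \<zeta>"
    have "cmod (of_real t * ?r + ?s) \<le> cmod (of_real s * ?r + ?s) + cmod (of_real (t - s) * ?r)"
    proof -
      have "of_real t * ?r + ?s = (of_real s * ?r + ?s) + of_real (t - s) * ?r"
        by (simp add: algebra_simps)
      thus ?thesis by (metis norm_triangle_ineq)
    qed
    also have "\<dots> = cmod (of_real s * ?r + ?s) + \<bar>t - s\<bar> * cmod ?r"
      by (simp only: norm_mult norm_of_real)
    finally have "imex_ratio M t \<zeta> \<le> imex_ratio M s \<zeta> + \<bar>t - s\<bar> * (cmod ?r / cmod (poly (sigma_star M) \<zeta>))"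
      using sigma_star_nz[OF that] by (simp add: imex_ratio_def field_simps)
    moreover have "\<bar>t - s\<bar> * (cmod ?r / cmod (poly (sigma_star M) \<zeta>)) \<le> \<bar>t - s\<bar> * K"
      using \<xi>[OF that] unfolding K_def by (intro mult_left_mono) auto
    ultimately show ?thesis by (simp add: mult.commute)
  qed
  have inf: "imex_inf M t \<le> imex_inf M s + K * \<bar>t - s\<bar>" for s t
  proof -
    obtain \<zeta> where \<zeta>: "cmod \<zeta> = 1" "imex_inf M s = imex_ratio M s \<zeta>"
      using imex_inf_attained by blast
    show ?thesis using ratio[OF \<zeta>(1), of t s] imex_inf_le[OF \<zeta>(1), of M t] \<zeta>(2) by linarith
  qed
  have "K-lipschitz_on X (imex_inf M)"
  proof (rule lipschitz_onI)
    fix s t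
    show "dist (imex_inf M s) (imex_inf M t) \<le> K * dist s t"
      using inf[of s t] inf[of t s] by (simp add: dist_real_def abs_le_iff abs_minus_commute)
  qed (simp add: K_def)
  thus ?thesis by (rule lipschitz_on_continuous_on)
qed

lemma r0_less_sigma_inf:
  assumes "z < 0" "r0 < 1"
  shows "r0 < sigma_inf M z"
  using imex_inf_strict_mono[of 0 "- 1 / z"] imex_inf_le_1[of "- 1 / z"] assms
  by (cases "imex_inf M (- 1 / z) = 1") (auto simp: sigma_inf_eq_imex_inf imex_inf_0 divide_neg_neg)

lemma less_sigma_inf_iff:
  assumes z: "z < 0" and r: "r0 < r" "r < 1"
  shows "r < sigma_inf M z \<longleftrightarrow> - z < \<bar>LEAST y. y < 0 \<and> sigma_inf M y = r\<bar>"
proof -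
  have "\<exists>t\<ge>0. t \<le> T \<and> imex_inf M t = r"
    using r T_nonneg continuous_on_imex_inf
    by (intro IVT') (auto simp: imex_inf_0 imex_inf_T)
  then obtain t where t: "t \<ge> 0" "imex_inf M t = r" by blast
  have "t \<noteq> 0" using t r imex_inf_0 by auto
  hence tpos: "t > 0" using t by simp
  \<comment> \<open>Strict growth below level 1 makes the level set a single point, so the
    \<open>LEAST\<close> below is its only element \<open>- 1 / t\<close>.\<close>
  have unique: "s = t" if "s > 0" "imex_inf M s = r" for s
    using imex_inf_strict_mono[of s t] imex_inf_strict_mono[of t s] that t r tpos
    by (cases s t rule: linorder_cases) auto
  have "(LEAST y. y < 0 \<and> sigma_inf M y = r) = - 1 / t"
  proof (rule Least_equality)
    show "- 1 / t < 0 \<and> sigma_inf M (- 1 / t) = r"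
      using tpos t by (simp add: sigma_inf_eq_imex_inf)
    fix y assume y: "y < 0 \<and> sigma_inf M y = r"
    hence "- 1 / y = t"
      by (intro unique) (auto simp: sigma_inf_eq_imex_inf divide_neg_neg)
    thus "- 1 / t \<le> y" using y by auto
  qed
  hence "- z < \<bar>LEAST y. y < 0 \<and> sigma_inf M y = r\<bar> \<longleftrightarrow> - z < 1 / t"
    using tpos by simp
  also have "\<dots> \<longleftrightarrow> t < - 1 / z"
    using z tpos by (simp add: field_simps)
  also have "\<dots> \<longleftrightarrow> r < imex_inf M (- 1 / z)"
  proof
    assume "t < - 1 / z"
    thus "r < imex_inf M (- 1 / z)"
      using imex_inf_strict_mono[of t "- 1 / z"] t r by fastforce
  next
    assume *: "r < imex_inf M (- 1 / z)"
    show "t < - 1 / z"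
    proof (rule ccontr)
      assume "\<not> t < - 1 / z"
      thus False using * t r imex_inf_strict_mono[of "- 1 / z" t] z
        by (cases "t = - 1 / z") (auto simp: divide_neg_neg)
    qed
  qed
  finally show ?thesis using z by (simp add: sigma_inf_eq_imex_inf)
qed

lemma step_size_less_iff:
  assumes "h > 0" "l > 0" "r0 < 1" "r < 1"
  shows "ereal h < (if r \<le> r0 then \<infinity> else ereal \<bar>LEAST y. y < 0 \<and> sigma_inf M y = r\<bar>) / ereal l
    \<longleftrightarrow> r < sigma_inf M (- h * l)"
proof -
  have "- h * l < 0" using assms by simp
  thus ?thesis using less_sigma_inf_iff[of "- h * l" r] r0_less_sigma_inf[of "- h * l"] assms
    by (cases "r \<le> r0") (auto simp: pos_less_divide_eq)
qed

end

section \<open>The two BDF methods\<close>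

lemma norm_1_Re: "cmod \<zeta> = 1 \<Longrightarrow> 0 \<le> 1 - Re \<zeta> \<and> 1 - Re \<zeta> \<le> 2"
  using abs_Re_le_cmod[of \<zeta>] by (auto simp: abs_le_iff)

lemma norm_1_Re_less: "cmod \<zeta> = 1 \<Longrightarrow> \<zeta> \<noteq> 1 \<Longrightarrow> 0 < 1 - Re \<zeta>"
proof -
  assume "cmod \<zeta> = 1" "\<zeta> \<noteq> 1"
  hence "(Re \<zeta>)\<^sup>2 + (Im \<zeta>)\<^sup>2 = 1" by (metis cmod_power2 one_power2)
  hence "Re \<zeta> \<noteq> 1" using \<open>\<zeta> \<noteq> 1\<close> by (auto simp: complex_eq_iff)
  thus ?thesis using norm_1_Re[OF \<open>cmod \<zeta> = 1\<close>] by simp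
qed

text \<open>By the double and triple angle formulas every imaginary part contains the factor Im
  \<zeta>, whose square is 1 - c^2; so the squared modulus is a polynomial in Re \<zeta>.\<close>

lemma cmod_linear_combination_unit_circle:
  assumes "cmod \<zeta> = 1"
  defines "c \<equiv> Re \<zeta>"
  shows "(cmod (of_real a0 + of_real a1 * \<zeta> + of_real a2 * \<zeta>^2 + of_real a3 * \<zeta>^3))\<^sup>2
     = (a0 + a1 * c + a2 * (2 * c^2 - 1) + a3 * (4 * c^3 - 3 * c))\<^sup>2
       + (1 - c^2) * (a1 + a2 * (2 * c) + a3 * (4 * c^2 - 1))\<^sup>2"
proof -
  define s where "s = Im \<zeta>"
  have "c\<^sup>2 + s\<^sup>2 = 1" unfolding c_def s_def using assms(1) by (metis cmod_power2 one_power2)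
  hence s: "s^2 = 1 - c^2" by simp
  have z: "\<zeta> = Complex c s" by (simp add: c_def s_def)
  have z2: "\<zeta>^2 = Complex (2 * c^2 - 1) (2 * c * s)"
    using s by (simp add: z power2_eq_square complex_eq_iff)
  have "\<zeta>^3 = \<zeta> * \<zeta>^2" by (simp add: power3_eq_cube power2_eq_square)
  also have "\<dots> = Complex (2 * c^3 - c - 2 * c * s^2) (2 * c^2 * s + s * (2 * c^2 - 1))"
    unfolding z2 by (simp add: z complex_eq_iff power2_eq_square power3_eq_cube algebra_simps)
  also have "\<dots> = Complex (4 * c^3 - 3 * c) (s * (4 * c^2 - 1))"
    unfolding s by (simp add: complex_eq_iff power2_eq_square power3_eq_cube algebra_simps)
  finally have z3: "\<zeta>^3 = Complex (4 * c^3 - 3 * c) (s * (4 * c^2 - 1))" .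
  have "of_real a0 + of_real a1 * \<zeta> + of_real a2 * \<zeta>^2 + of_real a3 * \<zeta>^3
    = Complex (a0 + a1 * c + a2 * (2 * c^2 - 1) + a3 * (4 * c^3 - 3 * c))
        (s * (a1 + a2 * (2 * c) + a3 * (4 * c^2 - 1)))"
    unfolding z2 z3 by (simp add: z complex_eq_iff algebra_simps)
  thus ?thesis by (simp add: cmod_power2 power_mult_distrib s)
qed

lemma bdf2_ratio_sq:
  assumes "cmod \<zeta> = 1"
  defines "x \<equiv> 1 - Re \<zeta>"
  shows "(cmod (poly (sigma_star imex_bdf2) \<zeta>))\<^sup>2 = 1 + 4 * x"
    and "(imex_ratio imex_bdf2 t \<zeta>)\<^sup>2 = (1 + 2 * t * x^2 + t^2 * (2 * x + 3 * x^2)) / (1 + 4 * x)"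
proof -
  have "poly (sigma_star imex_bdf2) \<zeta>
      = of_real (-1) + of_real 2 * \<zeta> + of_real 0 * \<zeta>^2 + of_real 0 * \<zeta>^3"
    by (simp add: imex_bdf2_def)
  thus star: "(cmod (poly (sigma_star imex_bdf2) \<zeta>))\<^sup>2 = 1 + 4 * x"
    by (simp only: cmod_linear_combination_unit_circle[OF assms(1)])
       (simp add: x_def power2_eq_square algebra_simps)
  have num_eq: "of_real t * poly (rho imex_bdf2) \<zeta> + poly (sigma imex_bdf2) \<zeta>
      = of_real (t / 2) + of_real (- 2 * t) * \<zeta> + of_real (3 / 2 * t + 1) * \<zeta>^2 + of_real 0 * \<zeta>^3"
    by (simp add: imex_bdf2_def power2_eq_square algebra_simps)
  have "(cmod (of_real t * poly (rho imex_bdf2) \<zeta> + poly (sigma imex_bdf2) \<zeta>))\<^sup>2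
      = 1 + 2 * t * x^2 + t^2 * (2 * x + 3 * x^2)"
    unfolding num_eq cmod_linear_combination_unit_circle[OF assms(1)] x_def
    by (simp add: field_simps power2_eq_square power3_eq_cube)
  thus "(imex_ratio imex_bdf2 t \<zeta>)\<^sup>2 = (1 + 2 * t * x^2 + t^2 * (2 * x + 3 * x^2)) / (1 + 4 * x)"
    by (simp add: imex_ratio_def power_divide star)
qed

lemma bdf3_ratio_sq:
  assumes "cmod \<zeta> = 1"
  defines "x \<equiv> 1 - Re \<zeta>"
  shows "(cmod (poly (sigma_star imex_bdf3) \<zeta>))\<^sup>2 = 1 + 12 * x^2"
    and "(imex_ratio imex_bdf3 t \<zeta>)\<^sup>2
      = (1 + 2 * t * (4 / 3 * x^3 - x^2) + t^2 * (2 * x + x^2 / 3 + 44 / 9 * x^3)) / (1 + 12 * x^2)"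
proof -
  have star_eq: "poly (sigma_star imex_bdf3) \<zeta>
      = of_real 1 + of_real (-3) * \<zeta> + of_real 3 * \<zeta>^2 + of_real 0 * \<zeta>^3"
    by (simp add: imex_bdf3_def power2_eq_square algebra_simps)
  show star: "(cmod (poly (sigma_star imex_bdf3) \<zeta>))\<^sup>2 = 1 + 12 * x^2"
    unfolding star_eq cmod_linear_combination_unit_circle[OF assms(1)] x_def by algebra
  have num_eq: "of_real t * poly (rho imex_bdf3) \<zeta> + poly (sigma imex_bdf3) \<zeta>
      = of_real (- t / 3) + of_real (3 / 2 * t) * \<zeta> + of_real (- 3 * t) * \<zeta>^2
        + of_real (11 / 6 * t + 1) * \<zeta>^3"
    by (simp add: imex_bdf3_def power2_eq_square power3_eq_cube algebra_simps)
  have "(cmod (of_real t * poly (rho imex_bdf3) \<zeta> + poly (sigma imex_bdf3) \<zeta>))\<^sup>2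
      = 1 + 2 * t * (4 / 3 * x^3 - x^2) + t^2 * (2 * x + x^2 / 3 + 44 / 9 * x^3)"
    unfolding num_eq cmod_linear_combination_unit_circle[OF assms(1)] x_def
    by (simp add: field_simps power2_eq_square power3_eq_cube)
  thus "(imex_ratio imex_bdf3 t \<zeta>)\<^sup>2
      = (1 + 2 * t * (4 / 3 * x^3 - x^2) + t^2 * (2 * x + x^2 / 3 + 44 / 9 * x^3)) / (1 + 12 * x^2)"
    by (simp add: imex_ratio_def power_divide star)
qed

section \<open>Monotonicity and extreme values of the two ratios\<close>

lemma imex_ratio_nonneg: "0 \<le> imex_ratio M t \<zeta>"
  by (simp add: imex_ratio_def)

interpretation bdf2: imex_profile imex_bdf2 "1/3" 2
proof
  fix \<zeta> :: complex assume \<zeta>: "cmod \<zeta> = 1"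
  define x where "x = 1 - Re \<zeta>"
  note sq = bdf2_ratio_sq[OF \<zeta>, folded x_def]
  have x: "0 \<le> x" "x \<le> 2" using norm_1_Re[OF \<zeta>] by (auto simp: x_def)
  show "poly (sigma_star imex_bdf2) \<zeta> \<noteq> 0"
    using sq(1) x by auto
  \<comment> \<open>The squared ratio is 1 / (1 + 4x) here, smallest at x = 2.\<close>
  have "(1/3)\<^sup>2 \<le> (imex_ratio imex_bdf2 0 \<zeta>)\<^sup>2"
    using x by (simp add: sq field_simps)
  thus "1/3 \<le> imex_ratio imex_bdf2 0 \<zeta>"
    by (rule power2_le_imp_le) (rule imex_ratio_nonneg)
  \<comment> \<open>At t = 2 the numerator is (1 + 4x)^2, so the squared ratio is 1 + 4x.\<close>
  have "1\<^sup>2 \<le> (imex_ratio imex_bdf2 2 \<zeta>)\<^sup>2"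
    using x by (simp add: sq field_simps)
  thus "1 \<le> imex_ratio imex_bdf2 2 \<zeta>"
    by (rule power2_le_imp_le) (rule imex_ratio_nonneg)
  fix s t :: real assume st: "0 \<le> s" "s < t" "\<zeta> \<noteq> 1"
  have xpos: "x > 0" unfolding x_def by (rule norm_1_Re_less[OF \<zeta> st(3)])
  have "s * x^2 \<le> t * x^2" using st by (intro mult_right_mono) auto
  moreover have "s^2 * (2 * x + 3 * x^2) < t^2 * (2 * x + 3 * x^2)"
    using st xpos by (intro mult_strict_right_mono power_strict_mono) (auto intro: add_pos_pos)
  ultimately have "(imex_ratio imex_bdf2 s \<zeta>)\<^sup>2 < (imex_ratio imex_bdf2 t \<zeta>)\<^sup>2"
    unfolding sq using xpos by (intro divide_strict_right_mono) linarith+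
  hence "imex_ratio imex_bdf2 s \<zeta> < imex_ratio imex_bdf2 t \<zeta>"
    by (rule power2_less_imp_less) (rule imex_ratio_nonneg)
  thus "imex_ratio imex_bdf2 s \<zeta> < imex_ratio imex_bdf2 t \<zeta>
    \<or> imex_ratio imex_bdf2 s (- 1) < imex_ratio imex_bdf2 t \<zeta>" ..
qed (simp_all add: imex_ratio_def imex_bdf2_def)

text \<open>
  The numerator can decrease in \<open>t\<close> only if \<open>s + t \<le> x - 4/3 x\<^sup>2 \<le> 3/16\<close>; for such small \<open>t\<close> the
  quotient at \<open>x = 2\<close>, i.e. at \<open>\<zeta> = -1\<close> where the denominator is \<open>49\<close>, is smaller still.
\<close>
lemma bdf3_numerator_less:
  fixes s t x :: real
  assumes s: "0 \<le> s" "s < t" and x: "0 < x" "x \<le> 2"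
  defines "N \<equiv> \<lambda>t x :: real. 1 + 2 * t * (4 / 3 * x^3 - x^2) + t^2 * (2 * x + x^2 / 3 + 44 / 9 * x^3)"
  shows "N s x < N t x \<or> N s 2 / 49 < N t x / (1 + 12 * x^2)"
proof -
  define P R where "P = 4 / 3 * x^3 - x^2" and "R = 2 * x + x^2 / 3 + 44 / 9 * x^3"
  have R: "R \<ge> 2 * x" using x by (simp add: R_def)
  have diff: "N t x - N s x = (t - s) * (2 * P + (s + t) * R)"
    by (simp add: N_def P_def R_def algebra_simps power2_eq_square add_divide_distrib diff_divide_distrib)
  show ?thesis
  proof (cases "2 * P + (s + t) * R > 0")
    case True
    hence "N t x - N s x > 0" unfolding diff using s by simp
    thus ?thesis by simp
  next
    case False
    \<comment> \<open>Keeping only the linear part of \<open>R\<close> leaves an inequality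
      divisible by 2x.\<close>
    hence "(s + t) * (2 * x) + 2 * P \<le> 0"
      using mult_left_mono[OF R, of "s + t"] s by linarith
    moreover have "(s + t) * (2 * x) + 2 * P = 2 * x * (s + t + 4 / 3 * x^2 - x)"
      by (simp add: P_def algebra_simps power2_eq_square power3_eq_cube)
    ultimately have st: "s + t \<le> x - 4 / 3 * x^2"
      using x by (simp add: mult_le_0_iff)
    \<comment> \<open>The parabola has its maximum at x = 3/8. Together with s < t this bounds
      \<open>s\<close> by half of 3/16.\<close>
    also have "\<dots> \<le> 3 / 16"
      using zero_le_power2[of "x - 3 / 8"] by (simp add: power2_eq_square algebra_simps)
    finally have small: "s \<le> 3 / 32" "t \<le> 3 / 16" using s by linarith+
    have "0 < x * (1 - 4 / 3 * x)"
      using st s by (simp add: power2_eq_square algebra_simps)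
    hence x': "x < 3 / 4" using x by (simp add: zero_less_mult_iff)
    \<comment> \<open>\<rho>(-1) = -20/3 and \<sigma>(-1) = -1; the bound 13/8 is the value of 1 +
      20/3 s at s = 3/32.\<close>
    have "N s 2 = (1 + 20 / 3 * s)\<^sup>2"
      by (simp add: N_def power2_eq_square algebra_simps)
    also have "\<dots> \<le> (13 / 8)\<^sup>2" using s small by (intro power_mono) auto
    finally have 1: "N s 2 / 49 \<le> 6 / 100" by (simp add: power2_eq_square)
    have x2: "x^2 \<le> 9 / 16" using power_mono[of x "3/4" 2] x x' by (simp add: power2_eq_square)
    have "2 * t * x^2 \<le> 2 * (3 / 16) * (9 / 16)"
      using s small x2 by (intro mult_mono) auto
    moreover have "2 * t * (4 / 3 * x^3 - x^2) \<ge> - (2 * t * x^2)"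
      using s x by (simp add: algebra_simps)
    moreover have "t^2 * (2 * x + x^2 / 3 + 44 / 9 * x^3) \<ge> 0" using x by simp
    ultimately have "N t x \<ge> 78 / 100" unfolding N_def by linarith
    moreover have "1 + 12 * x^2 \<le> 31 / 4" using x2 by linarith
    ultimately have "6 / 100 * (1 + 12 * x^2) < N t x" unfolding distrib_left by linarith
    hence "6 / 100 < N t x / (1 + 12 * x^2)"
      by (subst pos_less_divide_eq) (auto intro: add_pos_nonneg)
    thus ?thesis using 1 by linarith
  qed
qed

interpretation bdf3: imex_profile imex_bdf3 "1/7" 10
proof
  fix \<zeta> :: complex assume \<zeta>: "cmod \<zeta> = 1"
  define x where "x = 1 - Re \<zeta>"
  note sq = bdf3_ratio_sq[OF \<zeta>, folded x_def]
  have x: "0 \<le> x" "x \<le> 2" using norm_1_Re[OF \<zeta>] by (auto simp: x_def)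
  have pos: "1 + 12 * x^2 > 0" by (auto intro: add_pos_nonneg)
  show "poly (sigma_star imex_bdf3) \<zeta> \<noteq> 0"
    using sq(1) pos by auto
  \<comment> \<open>With x^2 \<le> 4 the denominator 1 + 12 x^2 is at most 49, which gives the level
    1/7 at t = 0.\<close>
  have x2: "x^2 \<le> 2 * x" using mult_right_mono[OF x(2) x(1)] by (simp add: power2_eq_square)
  hence "x^2 \<le> 4" using x by linarith
  hence "(1/7)\<^sup>2 \<le> (imex_ratio imex_bdf3 0 \<zeta>)\<^sup>2"
    using pos by (simp add: sq field_simps)
  thus "1/7 \<le> imex_ratio imex_bdf3 0 \<zeta>"
    by (rule power2_le_imp_le) (rule imex_ratio_nonneg)
  \<comment> \<open>At t = 10 the term 200 x outweighs 12 x^2 + 20 x^2 because x^2 \<le> 2x; the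
    other terms are nonnegative.\<close>
  have "x^3 \<ge> 0" "x^2 \<ge> 0" using x by auto
  hence "1 + 12 * x^2 \<le> 1 + 20 * (4 / 3 * x^3 - x^2) + 100 * (2 * x + x^2 / 3 + 44 / 9 * x^3)"
    using x x2 unfolding distrib_left right_diff_distrib by linarith
  hence "1\<^sup>2 \<le> (imex_ratio imex_bdf3 10 \<zeta>)\<^sup>2"
    unfolding sq using pos by (subst pos_le_divide_eq) auto
  thus "1 \<le> imex_ratio imex_bdf3 10 \<zeta>"
    by (rule power2_le_imp_le) (rule imex_ratio_nonneg)
  fix s t :: real assume st: "0 \<le> s" "s < t" "\<zeta> \<noteq> 1"
  have "x > 0" unfolding x_def by (rule norm_1_Re_less[OF \<zeta> st(3)])
  from bdf3_numerator_less[OF st(1,2) this x(2)]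
  have "(imex_ratio imex_bdf3 s \<zeta>)\<^sup>2 < (imex_ratio imex_bdf3 t \<zeta>)\<^sup>2
    \<or> (imex_ratio imex_bdf3 s (- 1))\<^sup>2 < (imex_ratio imex_bdf3 t \<zeta>)\<^sup>2"
  proof (elim disj_forward)
    show "(imex_ratio imex_bdf3 s (- 1))\<^sup>2 < (imex_ratio imex_bdf3 t \<zeta>)\<^sup>2"
      if "(1 + 2 * s * (4 / 3 * 2^3 - 2^2) + s^2 * (2 * 2 + 2^2 / 3 + 44 / 9 * 2^3)) / 49
        < (1 + 2 * t * (4 / 3 * x^3 - x^2) + t^2 * (2 * x + x^2 / 3 + 44 / 9 * x^3)) / (1 + 12 * x^2)"
    proof -
      have "(imex_ratio imex_bdf3 s (- 1))\<^sup>2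
          = (1 + 2 * s * (4 / 3 * 2^3 - 2^2) + s^2 * (2 * 2 + 2^2 / 3 + 44 / 9 * 2^3)) / 49"
        using bdf3_ratio_sq(2)[of "-1" s] by simp
      thus ?thesis using that by (simp only: sq)
    qed
  qed (unfold sq, rule divide_strict_right_mono[OF _ pos])
  thus "imex_ratio imex_bdf3 s \<zeta> < imex_ratio imex_bdf3 t \<zeta>
    \<or> imex_ratio imex_bdf3 s (- 1) < imex_ratio imex_bdf3 t \<zeta>"
    using power2_less_imp_less imex_ratio_nonneg by blast
qed (simp_all add: imex_ratio_def imex_bdf3_def)

section \<open>Zeros of \<rho> - z \<sigma> for z < 0\<close>

text \<open>
  In \<open>u = 1 - w = a + b \<i>\<close> the polynomials \<open>\<rho>(\<zeta>) / \<zeta>\<^sup>s\<close>, \<open>w = 1/\<zeta>\<close>, are \<open>u + u\<^sup>2/2\<close> and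
  \<open>u + u\<^sup>2/2 + u\<^sup>3/3\<close>; the vanishing imaginary part forces \<open>b = 0\<close>.
\<close>
lemma bdf2_reversed_nonzero:
  assumes "z < 0" "cmod w \<le> 1"
  shows "poly [:3/2 - of_real z, -2, 1/2:] w \<noteq> 0"
proof
  assume 0: "poly [:3/2 - of_real z, -2, 1/2:] w = 0"
  define a b where "a = 1 - Re w" and "b = - Im w"
  have w: "w = 1 - Complex a b" by (simp add: a_def b_def complex_eq_iff)
  have a: "a \<ge> 0" using assms(2) complex_Re_le_cmod[of w] by (simp add: a_def)
  from 0 have re: "a + (a^2 - b^2) / 2 = z" and im: "b * (1 + a) = 0"
    by (simp_all add: w complex_eq_iff power2_eq_square field_simps)
  from im a have "b = 0" by auto
  hence "z \<ge> 0" using re a by auto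
  thus False using assms(1) by simp
qed

lemma bdf3_reversed_nonzero:
  assumes "z < 0" "cmod w \<le> 1"
  shows "poly [:11/6 - of_real z, -3, 3/2, -1/3:] w \<noteq> 0"
proof
  assume 0: "poly [:11/6 - of_real z, -3, 3/2, -1/3:] w = 0"
  define a b where "a = 1 - Re w" and "b = - Im w"
  have w: "w = 1 - Complex a b" by (simp add: a_def b_def complex_eq_iff)
  have a: "a \<ge> 0" using assms(2) complex_Re_le_cmod[of w] by (simp add: a_def)
  have "(cmod w)\<^sup>2 \<le> 1" using assms(2) by (simp add: power_le_one)
  hence "(1 - a)\<^sup>2 + b\<^sup>2 \<le> 1" unfolding cmod_power2 by (simp add: w)
  hence b: "b^2 \<le> 2 * a - a^2" by (simp add: power2_eq_square algebra_simps)
  from 0 have re: "a + (a^2 - b^2) / 2 + (a^3 - 3 * a * b^2) / 3 = z"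
    and im: "b * (3 + 3 * a + 3 * a^2 - b^2) = 0"
    by (simp_all add: w complex_eq_iff power2_eq_square power3_eq_cube field_simps)
  \<comment> \<open>The bound on b^2, which encodes |w| \<le> 1, makes this factor at least 3 + a +
    4 a^2.\<close>
  have "3 + 3 * a + 3 * a^2 - b^2 > 0" using a b zero_le_power2[of a] by linarith
  hence "b = 0" using im by auto
  hence "z \<ge> 0" using re a by auto
  thus False using assms(1) by simp
qed

section \<open>Stability criteria for the system\<close>

theorem proposition17:
  fixes A B :: "complex^'d^'d"
    and v :: "'d \<Rightarrow> complex^'d"
    and lam :: "'d \<Rightarrow> real"
    and gam mu :: "'d \<Rightarrow> complex"
    and \<tau> :: real
  assumes "inj v" and "vec.independent (range v)" and "vec.span (range v) = UNIV"
    and "\<And>i. A *v v i = complex_of_real (lam i) *s v i"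
    and "\<And>i. B *v v i = gam i *s v i"
    and "\<And>i. lam i > 0"
    and "\<And>i. mu i = inverse (complex_of_real (lam i)) * gam i"
    and "\<tau> > 0"
  shows
    "(\<forall>M\<in>{imex_bdf2, imex_bdf3}. \<forall>m\<ge>1.
        (\<forall>i. mu i \<in> ball 0 (sigma_inf M (- (\<tau> / real m) * lam i)))
        \<longrightarrow> imex_stable M A B \<tau> m)
     \<and> ((\<forall>i. cmod (mu i) < 1) \<longrightarrow>
        (\<forall>m\<ge>1.
          (ereal (\<tau> / real m) < (MIN i. abs_chi (cmod (mu i)) / ereal (lam i))
             \<longleftrightarrow> (\<forall>i. mu i \<in> ball 0 (psi (- (\<tau> / real m) * lam i))))
          \<and> (ereal (\<tau> / real m) < (MIN i. abs_chi (cmod (mu i)) / ereal (lam i))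
             \<longrightarrow> imex_stable imex_bdf2 A B \<tau> m)
          \<and> (ereal (\<tau> / real m) < (MIN i. abs_chi_tilde (cmod (mu i)) / ereal (lam i))
             \<longleftrightarrow> (\<forall>i. mu i \<in> ball 0 (psi_tilde (- (\<tau> / real m) * lam i))))
          \<and> (ereal (\<tau> / real m) < (MIN i. abs_chi_tilde (cmod (mu i)) / ereal (lam i))
             \<longrightarrow> imex_stable imex_bdf3 A B \<tau> m)))
     \<and> ((\<forall>i. cmod (mu i) \<le> 1/3) \<longrightarrow> imex_unconditionally_stable imex_bdf2 A B \<tau>)
     \<and> ((\<forall>i. cmod (mu i) \<le> 1/3) \<and> (\<forall>i. cmod (mu i) \<le> 1/7)
          \<longrightarrow> imex_unconditionally_stable imex_bdf3 A B \<tau>)"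
proof -
  have stable2: "imex_stable imex_bdf2 A B \<tau> m"
    if "m \<ge> 1" "\<forall>i. mu i \<in> ball 0 (sigma_inf imex_bdf2 (- (\<tau> / real m) * lam i))" for m
  \<comment> \<open>\<open>P\<close> and \<open>Q\<close> are the coefficients in reverse order, as
    polynomials in 1/\<zeta>. The leading 0 in \<open>Q\<close> reflects that \<sigma>* has degree s
    - 1.\<close>
  proof (rule imex_stable_if_sigma_inf[OF assms(3-8) that(1), where s = 2
        and P = "\<lambda>z. [:3/2 - of_real z, -2, 1/2:]" and Q = "[:0, 2, -1:]"])
    show "cmod (mu i) < sigma_inf imex_bdf2 (- (\<tau> / real m) * lam i)" for i
      using that(2) by simp
  qed (use bdf2_reversed_nonzero in
      \<open>simp_all add: imex_bdf2_def field_simps power2_eq_square del: poly_pCons, simp_all add: field_simps\<close>)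
  have stable3: "imex_stable imex_bdf3 A B \<tau> m"
    if "m \<ge> 1" "\<forall>i. mu i \<in> ball 0 (sigma_inf imex_bdf3 (- (\<tau> / real m) * lam i))" for m
  proof (rule imex_stable_if_sigma_inf[OF assms(3-8) that(1), where s = 3
        and P = "\<lambda>z. [:11/6 - of_real z, -3, 3/2, -1/3:]" and Q = "[:0, 3, -3, 1:]"])
    show "cmod (mu i) < sigma_inf imex_bdf3 (- (\<tau> / real m) * lam i)" for i
      using that(2) by simp
  qed (use bdf3_reversed_nonzero in
      \<open>simp_all add: imex_bdf3_def field_simps power3_eq_cube del: poly_pCons, simp_all add: field_simps\<close>)
  have step: "\<tau> / real m > 0" if "m \<ge> 1" for m
    using assms(8) that by simp
  have z: "- (\<tau> / real m) * lam i < 0" if "m \<ge> 1" for m i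
    using step[OF that] assms(6)[of i] by (simp only: mult_neg_pos neg_less_0_iff_less)
  have iff2: "ereal (\<tau> / real m) < (MIN i. abs_chi (cmod (mu i)) / ereal (lam i))
      \<longleftrightarrow> (\<forall>i. mu i \<in> ball 0 (psi (- (\<tau> / real m) * lam i)))"
    if "\<forall>i. cmod (mu i) < 1" "m \<ge> 1" for m
  proof -
    have "ereal (\<tau> / real m) < abs_chi (cmod (mu i)) / ereal (lam i)
        \<longleftrightarrow> mu i \<in> ball 0 (psi (- (\<tau> / real m) * lam i))" for i
      unfolding abs_chi_def chi_def psi_def mem_ball_0
      using that(1) by (intro bdf2.step_size_less_iff[OF step[OF that(2)] assms(6)]) auto
    thus ?thesis by (subst Min_gr_iff) auto
  qed
  have iff3: "ereal (\<tau> / real m) < (MIN i. abs_chi_tilde (cmod (mu i)) / ereal (lam i))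
      \<longleftrightarrow> (\<forall>i. mu i \<in> ball 0 (psi_tilde (- (\<tau> / real m) * lam i)))"
    if "\<forall>i. cmod (mu i) < 1" "m \<ge> 1" for m
  proof -
    have "ereal (\<tau> / real m) < abs_chi_tilde (cmod (mu i)) / ereal (lam i)
        \<longleftrightarrow> mu i \<in> ball 0 (psi_tilde (- (\<tau> / real m) * lam i))" for i
      unfolding abs_chi_tilde_def chi_tilde_def psi_tilde_def mem_ball_0
      using that(1) by (intro bdf3.step_size_less_iff[OF step[OF that(2)] assms(6)]) auto
    thus ?thesis by (subst Min_gr_iff) auto
  qed
  \<comment> \<open>The infimum exceeds 1/3 strictly for every step size, so the non-strict bound on
    |\<mu>| suffices.\<close>
  have uncond2: "imex_unconditionally_stable imex_bdf2 A B \<tau>" if "\<forall>i. cmod (mu i) \<le> 1/3"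
    unfolding imex_unconditionally_stable_def
  proof (intro allI impI stable2)
    fix m :: nat and i assume "1 \<le> m"
    show "mu i \<in> ball 0 (sigma_inf imex_bdf2 (- (\<tau> / real m) * lam i))"
      unfolding mem_ball_0
      by (rule le_less_trans[OF spec[OF that] bdf2.r0_less_sigma_inf[OF z[OF \<open>1 \<le> m\<close>]]]) simp
  qed
  have uncond3: "imex_unconditionally_stable imex_bdf3 A B \<tau>" if "\<forall>i. cmod (mu i) \<le> 1/7"
    unfolding imex_unconditionally_stable_def
  proof (intro allI impI stable3)
    fix m :: nat and i assume "1 \<le> m"
    show "mu i \<in> ball 0 (sigma_inf imex_bdf3 (- (\<tau> / real m) * lam i))"
      unfolding mem_ball_0
      by (rule le_less_trans[OF spec[OF that] bdf3.r0_less_sigma_inf[OF z[OF \<open>1 \<le> m\<close>]]]) simp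
  qed
  show ?thesis
  proof (intro conjI impI allI ballI)
    show "imex_stable M A B \<tau> m"
      if "M \<in> {imex_bdf2, imex_bdf3}" "1 \<le> m"
        "\<forall>i. mu i \<in> ball 0 (sigma_inf M (- (\<tau> / real m) * lam i))" for M m
      using that stable2 stable3 by blast
  qed (use iff2 iff3 stable2 stable3 uncond2 uncond3 in \<open>auto simp: psi_def psi_tilde_def\<close>)
qed

end
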